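(* Let $\rho$ be a critical radius function on $\mathbb{R}^d$, let $1\le p<\infty$, and let $T$ be an operator such that for some Young function $\phi$ and for all $\theta\ge0$ there exists a constant $C$ such that $$\int|Tf|^p\,w\le C\int|f|^p\,M_\phi^\theta w$$ for any weight $w$ (and any function $f$ in the domain of $T$). Then, if a function $f$ satisfies $$\int_{\mathbb{R}^d}\frac{|f(x)|^p}{(1+|x|)^\sigma}\,dx<\infty\quad\text{for some }\sigma>0,$$ one has $Tf\in L^p_{\mathrm{loc}}(\mathbb{R}^d)$. In particular $Tf$ is finite almost everywhere.
   Context: A weight is a function $w\ge0$ in $L^1_{\mathrm{loc}}(\mathbb{R}^d)$. $T$ maps measurable functions in its domain to measurable functions, and the functions $f$ in the statement are taken in that domain. A critical radius function is a function $\rho:\mathbb{R}^d\to(0,\infty)$ for which there are constants $C_0,N_0\ge1$ such that for all $x,y$ $$C_0^{-1}\rho(x)\left(1+\tfrac{|x-y|}{\rho(x)}\right)^{-N_0}\le\rho(y)\le C_0\,\rho(x)\left(1+\tfrac{|x-y|}{\rho(x)}\right)^{\frac{N_0}{N_0+1}}.$$ A Young function is a continuous, convex, increasing $\phi:[0,\infty)\to[0,\infty)$ with $\phi(0)=0$. For a ball $B$, $\|f\|_{\phi,B}=\inf\{\lambda>0:\frac1{|B|}\int_B\phi(|f|/\lambda)\le1\}$, and for $\theta\ge0$ $$M_\phi^\theta f(x)=\sup_{B(x_0,r_0)\ni x}\left(1+\frac{r_0}{\rho(x_0)}\right)^{-\theta}\|f\|_{\phi,B(x_0,r_0)}.$$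 *)

theory Defs
  imports "HOL-Analysis.Analysis"
begin

(* The space R^d is an arbitrary type of class euclidean_space; "measurable" and |B| refer to
   Lebesgue measure. *)

definition critical_radius :: "('a::euclidean_space \<Rightarrow> real) \<Rightarrow> bool" where
  "critical_radius \<rho> \<longleftrightarrow>
     (\<forall>x. \<rho> x > 0) \<and>
     (\<exists>C\<^sub>0\<ge>1. \<exists>N\<^sub>0\<ge>1. \<forall>x y.
        inverse C\<^sub>0 * \<rho> x * (1 + norm (x - y) / \<rho> x) powr (- N\<^sub>0) \<le> \<rho> y \<and>
        \<rho> y \<le> C\<^sub>0 * \<rho> x * (1 + norm (x - y) / \<rho> x) powr (N\<^sub>0 / (N\<^sub>0 + 1)))"

(* Only the values on {0..} matter; "increasing" is read in the non-strict sense. *)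
definition young_function :: "(real \<Rightarrow> real) \<Rightarrow> bool" where
  "young_function \<phi> \<longleftrightarrow>
     \<phi> \<in> {0..} \<rightarrow> {0..} \<and> continuous_on {0..} \<phi> \<and> convex_on {0..} \<phi> \<and>
     mono_on {0..} \<phi> \<and> \<phi> 0 = 0"

definition weight :: "('a::euclidean_space \<Rightarrow> real) \<Rightarrow> bool" where
  "weight w \<longleftrightarrow> (\<forall>x. 0 \<le> w x) \<and> (\<forall>K. compact K \<longrightarrow> set_integrable lebesgue K w)"

(* The infimum is taken in ennreal, so it is \<infinity> when no t is admissible. *)
definition luxemburg :: "(real \<Rightarrow> real) \<Rightarrow> 'a::euclidean_space set \<Rightarrow> ('a \<Rightarrow> real) \<Rightarrow> ennreal" where
  "luxemburg \<phi> B f =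
     Inf {ennreal t | t. 0 < t \<and>
       (\<integral>\<^sup>+x\<in>B. ennreal (\<phi> (\<bar>f x\<bar> / t)) \<partial>lebesgue) / emeasure lebesgue B \<le> 1}"

definition maximal ::
  "('a::euclidean_space \<Rightarrow> real) \<Rightarrow> (real \<Rightarrow> real) \<Rightarrow> real \<Rightarrow> ('a \<Rightarrow> real) \<Rightarrow> 'a \<Rightarrow> ennreal" where
  "maximal \<rho> \<phi> \<theta> f x =
     (SUP (x\<^sub>0, r\<^sub>0) \<in> {(x\<^sub>0, r\<^sub>0). 0 < r\<^sub>0 \<and> x \<in> ball x\<^sub>0 r\<^sub>0}.
        ennreal ((1 + r\<^sub>0 / \<rho> x\<^sub>0) powr (- \<theta>)) * luxemburg \<phi> (ball x\<^sub>0 r\<^sub>0) f)"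

(* |y|^p for an extended real y and p > 0. *)
definition abs_powr :: "ereal \<Rightarrow> real \<Rightarrow> ennreal" where
  "abs_powr y p = (if \<bar>y\<bar> = \<infinity> then \<infinity> else ennreal (\<bar>real_of_ereal y\<bar> powr p))"

definition Lp_loc :: "real \<Rightarrow> ('a::euclidean_space \<Rightarrow> ereal) set" where
  "Lp_loc p = {g \<in> borel_measurable lebesgue.
     \<forall>K. compact K \<longrightarrow> (\<integral>\<^sup>+x\<in>K. abs_powr (g x) p \<partial>lebesgue) < \<infinity>}"

end

theory Submission
  imports Defs
begin

text \<open>
  Test the hypothesis on the weight \<open>w = indicator (ball 0 R)\<close>. A ball \<open>ball x\<^sub>0 r\<close> that contains \<open>x\<close> contributes
  to the maximal function at \<open>x\<close> only if it meets \<open>ball 0 R\<close>, so both \<open>norm x\<^sub>0\<close> and \<open>norm x\<close> are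
  at most of the order of \<open>1 + r\<close>. Since \<open>\<rho>\<close> grows at most like the power \<open>\<delta> = N\<^sub>0 / (N\<^sub>0 + 1) < 1\<close>, the factor
  \<open>1 + r / \<rho> x\<^sub>0\<close> is then at least of the order of \<open>(1 + norm x) powr (1 - \<delta>)\<close>. With
  \<open>\<theta> = \<sigma> / (1 - \<delta>)\<close> the maximal function is dominated by \<open>(1 + norm x) powr (- \<sigma>)\<close>.
\<close>

text \<open>Convexity together with \<open>\<phi> 0 = 0\<close> gives
  \<open>\<phi> s \<le> s * \<phi> 1\<close> on the unit interval. The maximum with 1 keeps the
  threshold inside that interval and avoids a division by zero when
  \<open>\<phi> 1 = 0\<close>.\<close>

lemma young_function_le_1:
  assumes "young_function \<phi>" "0 \<le> s" "s \<le> 1 / max 1 (\<phi> 1)"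
  shows "\<phi> s \<le> 1"
proof -
  have cv: "convex_on {0..} \<phi>" and z: "\<phi> 0 = 0"
    using assms(1) by (auto simp: young_function_def)
  have "1 / max 1 (\<phi> 1) \<le> 1" by (simp add: divide_simps)
  with assms(3) have "s \<le> 1" by linarith
  have "\<phi> s \<le> s * \<phi> 1"
    using convex_onD[OF cv, of s 0 1] \<open>0 \<le> s\<close> \<open>s \<le> 1\<close> z by simp
  also have "\<dots> \<le> s * max 1 (\<phi> 1)"
    using \<open>0 \<le> s\<close> by (intro mult_left_mono) auto
  also have "\<dots> \<le> 1"
    using assms(3) by (simp add: pos_le_divide_eq less_max_iff_disj)
  finally show ?thesis .
qed

text \<open>The value \<open>max 1 (\<phi> 1)\<close> is admissible in the infimum, because it makes
  the integrand at most 1 pointwise and hence its average too. The bound is independent of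
  \<open>B\<close>, so it survives the supremum over all balls.\<close>

lemma luxemburg_le:
  assumes "young_function \<phi>" "B \<in> sets lebesgue" "\<And>x. x \<in> B \<Longrightarrow> \<bar>f x\<bar> \<le> 1"
  shows "luxemburg \<phi> B f \<le> ennreal (max 1 (\<phi> 1))"
proof -
  define t where "t = max 1 (\<phi> 1)"
  have t: "0 < t" by (simp add: t_def less_max_iff_disj)
  have "\<phi> (\<bar>f x\<bar> / t) \<le> 1" if "x \<in> B" for x
    using young_function_le_1[OF assms(1), of "\<bar>f x\<bar> / t"] assms(3)[OF that] t
    by (simp add: t_def[symmetric] divide_right_mono)
  then have "(\<integral>\<^sup>+x\<in>B. ennreal (\<phi> (\<bar>f x\<bar> / t)) \<partial>lebesgue) \<le> (\<integral>\<^sup>+x. indicator B x \<partial>lebesgue)"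
    by (intro nn_integral_mono) (auto simp: indicator_def)
  then have le: "(\<integral>\<^sup>+x\<in>B. ennreal (\<phi> (\<bar>f x\<bar> / t)) \<partial>lebesgue) \<le> emeasure lebesgue B"
    using assms(2) by simp
  \<comment> \<open>In \<open>ennreal\<close> the quotients of 0 by 0 and of \<open>top\<close> by
    \<open>top\<close> are both 0, so sets of measure zero or infinity are covered as well.\<close>
  have "a / a \<le> 1" for a :: ennreal
  proof (cases "a = 0 \<or> a = top")
    case True
    then show ?thesis by (auto simp: divide_ennreal_def)
  next
    case False
    then show ?thesis by (simp add: ennreal_divide_self less_top)
  qed
  with divide_right_mono_ennreal[OF le, of "emeasure lebesgue B"]
  have "(\<integral>\<^sup>+x\<in>B. ennreal (\<phi> (\<bar>f x\<bar> / t)) \<partial>lebesgue) / emeasure lebesgue B \<le> 1"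
    using order_trans by blast
  with t show ?thesis
    unfolding luxemburg_def t_def[symmetric] by (intro Inf_lower) auto
qed

text \<open>Every positive \<open>t\<close> is admissible, since the integral vanishes. This
  disposes of the balls that miss the support of the test weight.\<close>

lemma luxemburg_eq_0:
  fixes B :: "'a::euclidean_space set"
  assumes "\<phi> 0 = 0" "\<And>x. x \<in> B \<Longrightarrow> f x = 0"
  shows "luxemburg \<phi> B f = 0"
proof -
  have "luxemburg \<phi> B f \<le> ennreal t" if "0 < t" for t
  proof -
    have eq: "ennreal (\<phi> (\<bar>f x\<bar> / t)) * indicator B x = 0" for x
      by (cases "x \<in> B") (simp_all add: assms)
    have "(\<integral>\<^sup>+x\<in>B. ennreal (\<phi> (\<bar>f x\<bar> / t)) \<partial>lebesgue) / emeasure lebesgue B \<le> 1"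
      unfolding eq by simp
    with that show ?thesis
      unfolding luxemburg_def by (intro Inf_lower CollectI exI[of _ t] conjI refl)
  qed
  then have "luxemburg \<phi> B f \<le> 0 + ennreal e" if "0 < e" for e
    using that by simp
  then have "luxemburg \<phi> B f \<le> 0"
    by (rule ennreal_le_epsilon)
  then show ?thesis by simp
qed

text \<open>This is the upper inequality for \<open>\<rho>\<close> with base point 0; all that
  matters later is that the exponent stays strictly below 1.\<close>

lemma critical_radius_growth:
  fixes \<rho> :: "'a::euclidean_space \<Rightarrow> real"
  assumes "critical_radius \<rho>"
  obtains A \<delta> where "1 \<le> A" "0 \<le> \<delta>" "\<delta> < 1" "\<And>x. \<rho> x \<le> A * (1 + norm x) powr \<delta>"
proof -
  obtain C N where pos: "\<And>x. \<rho> x > 0" and CN: "C \<ge> 1" "N \<ge> 1"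
    and up: "\<And>x y. \<rho> y \<le> C * \<rho> x * (1 + norm (x - y) / \<rho> x) powr (N / (N + 1))"
    using assms unfolding critical_radius_def by metis
  define \<delta> where "\<delta> = N / (N + 1)"
  \<comment> \<open>The factor \<open>m\<close> absorbs the scale \<open>\<rho> 0\<close>: it
    dominates both coefficients of \<open>1 + norm x / \<rho> 0\<close>.\<close>
  define m where "m = max 1 (1 / \<rho> 0)"
  define A where "A = max 1 (C * \<rho> 0 * m powr \<delta>)"
  have \<delta>: "0 \<le> \<delta>" "\<delta> < 1" using CN by (auto simp: \<delta>_def divide_simps)
  have m: "1 \<le> m" "1 / \<rho> 0 \<le> m" by (auto simp: m_def)
  show thesis
  proof
    fix x :: 'a
    have "norm x * (1 / \<rho> 0) \<le> norm x * m"
      using m by (intro mult_left_mono) auto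
    then have le: "1 + norm x / \<rho> 0 \<le> m * (1 + norm x)"
      using m by (simp add: algebra_simps)
    have "\<rho> x \<le> C * \<rho> 0 * (1 + norm x / \<rho> 0) powr \<delta>"
      using up[of x 0] by (simp add: \<delta>_def)
    also have "\<dots> \<le> C * \<rho> 0 * (m * (1 + norm x)) powr \<delta>"
      using le \<delta> CN pos[of 0] by (intro mult_left_mono powr_mono2) auto
    also have "\<dots> = C * \<rho> 0 * m powr \<delta> * (1 + norm x) powr \<delta>"
      using m by (simp add: powr_mult)
    also have "\<dots> \<le> A * (1 + norm x) powr \<delta>"
      by (intro mult_right_mono) (auto simp: A_def)
    finally show "\<rho> x \<le> A * (1 + norm x) powr \<delta>" .
  qed (use \<delta> in \<open>auto simp: A_def\<close>)
qed

lemma maximal_indicator_ball_decay: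
  fixes \<rho> :: "'a::euclidean_space \<Rightarrow> real"
  assumes "critical_radius \<rho>" "young_function \<phi>" "0 < \<sigma>" "0 \<le> R"
  obtains \<theta> D where "0 \<le> \<theta>" "0 \<le> D"
    "\<And>x. maximal \<rho> \<phi> \<theta> (indicator (ball 0 R)) x \<le> ennreal (D * (1 + norm x) powr - \<sigma>)"
proof -
  obtain A \<delta> where A: "1 \<le> A" and \<delta>: "0 \<le> \<delta>" "\<delta> < 1"
    and growth: "\<And>x. \<rho> x \<le> A * (1 + norm x) powr \<delta>"
    using critical_radius_growth[OF assms(1)] by blast
  have pos: "\<And>x. \<rho> x > 0" using assms(1) by (auto simp: critical_radius_def)
  have \<phi>0: "\<phi> 0 = 0" using assms(2) by (auto simp: young_function_def)
  define \<theta> where "\<theta> = \<sigma> / (1 - \<delta>)"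
  \<comment> \<open>\<open>A'\<close> comes from \<open>1 + norm y \<le> (1 + R) * (1 + r)\<close>,
    inserted into the growth bound at the centre \<open>y\<close>. The other factor of
    \<open>k\<close> comes from \<open>1 + norm x \<le> (2 + R) * (1 + r)\<close>.\<close>
  define A' where "A' = A * (1 + R) powr \<delta>"
  define k where "k = (2 + R) powr (1 - \<delta>) * A'"
  define D where "D = max 1 (\<phi> 1) * k powr \<theta>"
  have \<theta>: "0 \<le> \<theta>" "(1 - \<delta>) * \<theta> = \<sigma>" using \<delta> assms(3) by (auto simp: \<theta>_def)
  have "1 \<le> (1 + R) powr \<delta>" using assms(4) \<delta> by (intro ge_one_powr_ge_zero) auto
  with A have "1 * 1 \<le> A'" unfolding A'_def by (intro mult_mono) auto
  then have A': "1 \<le> A'" by simp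
  then have k: "0 < k" using assms(4) by (simp add: k_def)
  have decay: "(1 + r / \<rho> y) powr - \<theta> \<le> k powr \<theta> * (1 + norm x) powr - \<sigma>"
    if r: "0 < r" and x: "norm (x - y) < r" and y: "norm y < r + R" for x y :: 'a and r
  proof -
    have "norm x < 2 * r + R" using x y norm_triangle_sub[of x y] by linarith
    moreover have "0 \<le> R * r" using r assms(4) by simp
    ultimately have nx: "1 + norm x \<le> (2 + R) * (1 + r)"
      by (simp add: algebra_simps)
    have "1 + norm y \<le> (1 + R) * (1 + r)"
      using y \<open>0 \<le> R * r\<close> by (simp add: algebra_simps)
    then have "A * (1 + norm y) powr \<delta> \<le> A * ((1 + R) * (1 + r)) powr \<delta>"
      using A \<delta> by (intro mult_left_mono powr_mono2) auto
    also have "\<dots> = A' * (1 + r) powr \<delta>"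
      using assms(4) r by (simp add: powr_mult A'_def)
    finally have \<rho>y: "\<rho> y \<le> A' * (1 + r) powr \<delta>" using growth[of y] by linarith
    have one: "1 \<le> (1 + r) powr \<delta>" using r \<delta> by (intro ge_one_powr_ge_zero) auto
    \<comment> \<open>Enlarging the leading 1 of the numerator to
      \<open>(1 + r) powr \<delta>\<close> splits off a summand 1. Multiplying by
      \<open>A' \<ge> 1\<close> then lets \<open>\<rho> y\<close> replace its upper bound in the
      denominator.\<close>
    have "(1 + r) powr (1 - \<delta>) = (1 + r) / (1 + r) powr \<delta>"
      using r powr_diff[of "1 + r" 1 \<delta>] by simp
    also have "\<dots> \<le> ((1 + r) powr \<delta> + r) / (1 + r) powr \<delta>"
      using one by (intro divide_right_mono) auto
    also have "\<dots> = 1 + r / (1 + r) powr \<delta>"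
      using one r by (simp add: add_divide_distrib)
    also have "\<dots> \<le> A' + A' * (r / (A' * (1 + r) powr \<delta>))"
      using A' by simp
    also have "\<dots> \<le> A' + A' * (r / \<rho> y)"
      using A' r pos[of y] \<rho>y by (intro add_left_mono mult_left_mono divide_left_mono) auto
    finally have r_le: "(1 + r) powr (1 - \<delta>) \<le> A' * (1 + r / \<rho> y)"
      by (simp add: algebra_simps)
    have "(1 + norm x) powr (1 - \<delta>) \<le> ((2 + R) * (1 + r)) powr (1 - \<delta>)"
      using nx \<delta> by (intro powr_mono2) auto
    also have "\<dots> = (2 + R) powr (1 - \<delta>) * (1 + r) powr (1 - \<delta>)"
      using assms(4) r by (simp add: powr_mult)
    also have "\<dots> \<le> (2 + R) powr (1 - \<delta>) * (A' * (1 + r / \<rho> y))"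
      using r_le by (intro mult_left_mono) auto
    also have "\<dots> = k * (1 + r / \<rho> y)" by (simp add: k_def)
    \<comment> \<open>Raising to the power \<open>\<theta>\<close> turns the exponent
      \<open>1 - \<delta>\<close> into \<open>\<sigma>\<close>; taking reciprocals afterwards gives
      the decay.\<close>
    finally have "((1 + norm x) powr (1 - \<delta>)) powr \<theta> \<le> (k * (1 + r / \<rho> y)) powr \<theta>"
      using \<theta> by (intro powr_mono2) auto
    moreover have pr: "0 < 1 + r / \<rho> y" using r pos[of y] by (simp add: add_pos_pos)
    ultimately have "(1 + norm x) powr \<sigma> \<le> k powr \<theta> * (1 + r / \<rho> y) powr \<theta>"
      using k \<theta>(2) by (simp add: powr_powr powr_mult)
    moreover have "0 < (1 + norm x) powr \<sigma>" "0 < (1 + r / \<rho> y) powr \<theta>"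
      using pr norm_ge_zero[of x] by (simp_all add: add_nonneg_eq_0_iff)
    ultimately show ?thesis
      by (simp add: powr_minus divide_simps mult.commute)
  qed
  show thesis
  proof
    show "0 \<le> \<theta>" by (fact \<theta>(1))
    show "0 \<le> D" by (simp add: D_def le_max_iff_disj)
    fix x :: 'a
    have "ennreal ((1 + r / \<rho> y) powr - \<theta>) * luxemburg \<phi> (ball y r) (indicator (ball 0 R))
        \<le> ennreal (D * (1 + norm x) powr - \<sigma>)" if r: "0 < r" and x: "x \<in> ball y r" for y r
    \<comment> \<open>A disjoint ball contributes 0. Otherwise a common point \<open>z\<close>
      bounds \<open>norm y\<close> by \<open>r + R\<close>, as \<open>decay\<close>
      requires.\<close>
    proof (cases "ball y r \<inter> ball 0 R = {}")
      case True
      then have "luxemburg \<phi> (ball y r) (indicator (ball 0 R)) = 0"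
        by (intro luxemburg_eq_0 \<phi>0) (auto simp: indicator_def)
      then show ?thesis by simp
    next
      case False
      then obtain z where z: "dist y z < r" "norm z < R" by auto
      then have "norm y < r + R" using norm_triangle_sub[of y z] by (simp add: dist_norm)
      moreover have "norm (x - y) < r" using x by (simp add: dist_norm norm_minus_commute)
      ultimately have "(1 + r / \<rho> y) powr - \<theta> \<le> k powr \<theta> * (1 + norm x) powr - \<sigma>"
        using decay r by blast
      moreover have "luxemburg \<phi> (ball y r) (indicator (ball 0 R)) \<le> ennreal (max 1 (\<phi> 1))"
        by (intro luxemburg_le assms(2)) (auto simp: indicator_def)
      ultimately have "ennreal ((1 + r / \<rho> y) powr - \<theta>) * luxemburg \<phi> (ball y r) (indicator (ball 0 R))
          \<le> ennreal (k powr \<theta> * (1 + norm x) powr - \<sigma>) * ennreal (max 1 (\<phi> 1))"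
        by (intro mult_mono ennreal_leI) auto
      also have "\<dots> = ennreal (D * (1 + norm x) powr - \<sigma>)"
        by (subst ennreal_mult[symmetric]) (auto simp: D_def le_max_iff_disj mult_ac)
      finally show ?thesis .
    qed
    then show "maximal \<rho> \<phi> \<theta> (indicator (ball 0 R)) x \<le> ennreal (D * (1 + norm x) powr - \<sigma>)"
      unfolding maximal_def by (intro SUP_least) auto
  qed
qed

lemma weight_indicator_ball: "weight (indicator (ball 0 R))"
  unfolding weight_def set_integrable_def
proof (intro conjI allI impI)
  fix K :: "'a set" assume "compact K"
  then have "K \<inter> ball 0 R \<in> lmeasurable"
    by (intro fmeasurable_Int_fmeasurable) (auto intro: lmeasurable_compact)
  then have "integrable lebesgue (indicator (K \<inter> ball 0 R) :: 'a \<Rightarrow> real)"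
    by (intro integrable_real_indicator) (auto simp: fmeasurable_def)
  then show "integrable lebesgue (\<lambda>x. indicator K x *\<^sub>R (indicator (ball 0 R) x :: real))"
    by (simp add: indicator_inter_arith[abs_def])
qed auto

lemma abs_powr_measurable:
  assumes "g \<in> borel_measurable M"
  shows "(\<lambda>x. abs_powr (g x) p) \<in> borel_measurable M"
  using assms unfolding abs_powr_def by measurable

theorem theorem10:
  fixes \<rho> :: "'a::euclidean_space \<Rightarrow> real"
    and p :: real
    and \<D> :: "('a \<Rightarrow> ereal) set"
    and T :: "('a \<Rightarrow> ereal) \<Rightarrow> ('a \<Rightarrow> ereal)"
    and \<phi> :: "real \<Rightarrow> real"
    and f :: "'a \<Rightarrow> ereal"
  assumes "critical_radius \<rho>"
    and "1 \<le> p"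
    and "\<D> \<subseteq> borel_measurable lebesgue"
    and "T \<in> \<D> \<rightarrow> borel_measurable lebesgue"
    and "young_function \<phi>"
    and "\<And>\<theta>::real. 0 \<le> \<theta> \<Longrightarrow> \<exists>C::real. 0 \<le> C \<and>
           (\<forall>w g. weight w \<longrightarrow> g \<in> \<D> \<longrightarrow>
             (\<integral>\<^sup>+x. abs_powr (T g x) p * ennreal (w x) \<partial>lebesgue)
               \<le> ennreal C * (\<integral>\<^sup>+x. abs_powr (g x) p * maximal \<rho> \<phi> \<theta> w x \<partial>lebesgue))"
    and "f \<in> \<D>"
    and "\<exists>\<sigma>>0. (\<integral>\<^sup>+x. abs_powr (f x) p / ennreal ((1 + norm x) powr \<sigma>) \<partial>lebesgue) < \<infinity>"
  shows "T f \<in> Lp_loc p \<and> (AE x in lebesgue. \<bar>T f x\<bar> \<noteq> \<infinity>)"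
proof -
  obtain \<sigma> where \<sigma>: "\<sigma> > 0"
    and fin: "(\<integral>\<^sup>+x. abs_powr (f x) p / ennreal ((1 + norm x) powr \<sigma>) \<partial>lebesgue) < \<infinity>"
    using assms(8) by blast
  have fm: "f \<in> borel_measurable lebesgue" using assms(3,7) by blast
  have Tm: "T f \<in> borel_measurable lebesgue" using assms(4,7) by blast
  \<comment> \<open>The constants \<open>D\<close> and \<open>C\<close> may depend on
    \<open>R\<close>, since only finiteness on each ball is claimed. \<open>C\<close> is chosen
    after \<open>\<theta>\<close>, which is why the hypothesis is invoked for a specific
    \<open>\<theta>\<close> adapted to \<open>\<sigma>\<close>.\<close>
  have ball_fin: "(\<integral>\<^sup>+x. abs_powr (T f x) p * indicator (ball 0 R) x \<partial>lebesgue) < \<infinity>"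
    if R: "0 \<le> R" for R
  proof -
    obtain \<theta> D where \<theta>: "0 \<le> \<theta>" and D: "0 \<le> D"
      and M: "\<And>x. maximal \<rho> \<phi> \<theta> (indicator (ball 0 R)) x \<le> ennreal (D * (1 + norm x) powr - \<sigma>)"
      using maximal_indicator_ball_decay[OF assms(1,5) \<sigma> R] by blast
    obtain C where C: "\<And>w g. weight w \<Longrightarrow> g \<in> \<D> \<Longrightarrow>
        (\<integral>\<^sup>+x. abs_powr (T g x) p * ennreal (w x) \<partial>lebesgue)
          \<le> ennreal C * (\<integral>\<^sup>+x. abs_powr (g x) p * maximal \<rho> \<phi> \<theta> w x \<partial>lebesgue)"
      using assms(6)[OF \<theta>] by blast
    have "maximal \<rho> \<phi> \<theta> (indicator (ball 0 R)) x \<le> ennreal D / ennreal ((1 + norm x) powr \<sigma>)" for x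
    proof -
      have "0 < 1 + norm x" by (simp add: add_pos_nonneg)
      then have "0 < (1 + norm x) powr \<sigma>" by simp
      with D have "ennreal D / ennreal ((1 + norm x) powr \<sigma>) = ennreal (D * (1 + norm x) powr - \<sigma>)"
        by (simp add: divide_ennreal powr_minus_divide)
      with M[of x] show ?thesis by simp
    qed
    then have "abs_powr (f x) p * maximal \<rho> \<phi> \<theta> (indicator (ball 0 R)) x
        \<le> abs_powr (f x) p * (ennreal D / ennreal ((1 + norm x) powr \<sigma>))" for x
      by (intro mult_left_mono) auto
    then have le: "abs_powr (f x) p * maximal \<rho> \<phi> \<theta> (indicator (ball 0 R)) x
        \<le> ennreal D * (abs_powr (f x) p / ennreal ((1 + norm x) powr \<sigma>))" for x
      by (simp add: divide_ennreal_def mult_ac)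
    have "(\<integral>\<^sup>+x. abs_powr (T f x) p * indicator (ball 0 R) x \<partial>lebesgue)
        = (\<integral>\<^sup>+x. abs_powr (T f x) p * ennreal (indicator (ball 0 R) x) \<partial>lebesgue)"
      by (simp add: ennreal_indicator)
    also have "\<dots> \<le> ennreal C * (\<integral>\<^sup>+x. abs_powr (f x) p * maximal \<rho> \<phi> \<theta> (indicator (ball 0 R)) x \<partial>lebesgue)"
      by (intro C weight_indicator_ball assms(7))
    also have "\<dots> \<le> ennreal C * (\<integral>\<^sup>+x. ennreal D * (abs_powr (f x) p / ennreal ((1 + norm x) powr \<sigma>)) \<partial>lebesgue)"
      by (intro mult_left_mono nn_integral_mono le) auto
    also have "\<dots> = ennreal C * (ennreal D * (\<integral>\<^sup>+x. abs_powr (f x) p / ennreal ((1 + norm x) powr \<sigma>) \<partial>lebesgue))"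
    proof -
      \<comment> \<open>Pulling \<open>D\<close> out of the integral requires a measurable
        integrand; the Borel factor is transferred to the completed measure.\<close>
      have "(\<lambda>x::'a. (1 + norm x) powr \<sigma>) \<in> borel_measurable lebesgue"
        by (intro measurable_completion) measurable
      then have "(\<lambda>x. abs_powr (f x) p / ennreal ((1 + norm x) powr \<sigma>)) \<in> borel_measurable lebesgue"
        using abs_powr_measurable[OF fm, of p] by measurable
      then show ?thesis by (simp add: nn_integral_cmult)
    qed
    also have "\<dots> < \<infinity>" using fin by (simp add: ennreal_mult_less_top)
    finally show ?thesis .
  qed
  have "T f \<in> Lp_loc p"
    unfolding Lp_loc_def
  proof (intro CollectI conjI allI impI Tm)
    fix K :: "'a set" assume "compact K"
    then have "bounded K" by (rule compact_imp_bounded)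
    then obtain R where R: "0 < R" "K \<subseteq> ball 0 R"
      by (auto dest: bounded_subset_ballD)
    then have "(\<integral>\<^sup>+x\<in>K. abs_powr (T f x) p \<partial>lebesgue)
        \<le> (\<integral>\<^sup>+x. abs_powr (T f x) p * indicator (ball 0 R) x \<partial>lebesgue)"
      by (intro nn_integral_mono mult_left_mono) (auto simp: indicator_def)
    then show "(\<integral>\<^sup>+x\<in>K. abs_powr (T f x) p \<partial>lebesgue) < \<infinity>"
      using ball_fin[of R] R by simp
  qed
  \<comment> \<open>Integer radii leave only countably many exceptional null sets, and every point
    lies in one of these balls. There \<open>abs_powr\<close> is infinite exactly where
    \<open>T f\<close> is.\<close>
  moreover have "AE x in lebesgue. \<forall>n::nat. abs_powr (T f x) p * indicator (ball 0 (real n)) x \<noteq> \<infinity>"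
    unfolding AE_all_countable
  proof
    fix n :: nat
    show "AE x in lebesgue. abs_powr (T f x) p * indicator (ball 0 (real n)) x \<noteq> \<infinity>"
      using ball_fin[of "real n"] abs_powr_measurable[OF Tm, of p]
      by (intro nn_integral_noteq_infinite borel_measurable_times_ennreal borel_measurable_indicator) auto
  qed
  then have "AE x in lebesgue. \<bar>T f x\<bar> \<noteq> \<infinity>"
  proof eventually_elim
    fix x assume *: "\<forall>n::nat. abs_powr (T f x) p * indicator (ball 0 (real n)) x \<noteq> \<infinity>"
    obtain n :: nat where "norm x < real n" using reals_Archimedean2 by blast
    with * have "abs_powr (T f x) p \<noteq> \<infinity>" by (auto dest!: spec[of _ n])
    then show "\<bar>T f x\<bar> \<noteq> \<infinity>" by (auto simp: abs_powr_def)
  qed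
  ultimately show ?thesis by blast
qed

end
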